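(* $H_c^{(k)}$ is contracting for every $k\ge3$.
   Context: Let $\mathsf{X}$ be a finite alphabet and $\mathsf{X}^*$ the set of finite words over $\mathsf{X}$, viewed as a rooted tree; $\operatorname{Aut}\mathsf{X}^*$ is the group of permutations of $\mathsf{X}^*$ preserving word length and common prefixes. For $g\in\operatorname{Aut}\mathsf{X}^*$, the root permutation $\sigma_g\in\operatorname{Sym}(\mathsf{X})$ is the restriction of $g$ to one-letter words, and for $x\in\mathsf{X}$ the section $g|_x\in\operatorname{Aut}\mathsf{X}^*$ is defined by $g(xw)=\sigma_g(x)\,g|_x(w)$ for all $w\in\mathsf{X}^*$. For $w=x_n\ldots x_1$ set $g|_w=(g|_{x_n})|_{x_{n-1}\ldots x_1}$ inductively. A self-similar group $(G,\mathsf{X})$ is a subgroup $G\le\operatorname{Aut}\mathsf{X}^*$ with $g|_x\in G$ for all $g\in G$, $x\in\mathsf{X}$. It is contracting if there is a finite set $\mathcal{N}\subset G$ such that for every $g\in G$ there is $n\in\mathbb{N}$ with $g|_v\in\mathcal{N}$ for all words $v$ with $|v|\ge n$. Let $\mathsf{X}_k=\{0,\dots,k-1\}$. Let $S_{k,1}$ be the set of all $a\in\operatorname{Aut}\mathsf{X}_k^*$ for which there is a single peg $j\in\mathsf{X}_k$ (the inactive peg) such that $a|_j=a$, $\sigma_a(j)=j$, and $a|_i=1$ for all $i\ne j$. This set contains the identity. $H_c^{(k)}$ is the subgroup of $\operatorname{Aut}\mathsf{X}_k^*$ generated by $S_{k,1}$; it is a self-similar group. *)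

theory Defs
  imports "HOL-Algebra.Bij" "HOL-Algebra.Generated_Groups" "HOL-Library.Sublist"
begin

text \<open>
  Words over an alphabet \<open>X\<close> are the elements of \<^term>\<open>lists X\<close>. As in \<^const>\<open>BijGroup\<close>, maps on
  words are extensional (\<^const>\<open>undefined\<close> outside \<^term>\<open>lists X\<close>), so that equality in the group
  is equality of permutations of \<^term>\<open>lists X\<close>, and the product is composition, the right factor
  acting first.
\<close>

definition tree_aut :: "'a set \<Rightarrow> ('a list \<Rightarrow> 'a list) monoid" where
  "tree_aut X = BijGroup (lists X)
     \<lparr>carrier := {g \<in> Bij (lists X).
        (\<forall>w \<in> lists X. length (g w) = length w) \<and>
        (\<forall>u \<in> lists X. \<forall>v \<in> lists X.
           g (longest_common_prefix u v) = longest_common_prefix (g u) (g v))}\<rparr>"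

definition root_perm :: "'a set \<Rightarrow> ('a list \<Rightarrow> 'a list) \<Rightarrow> 'a \<Rightarrow> 'a" where
  "root_perm X g = (\<lambda>x\<in>X. hd (g [x]))"

text \<open>The defining equation \<open>g(xw) = \<sigma>\<^sub>g(x) g|\<^sub>x(w)\<close> is lemma \<open>tree_aut_Cons\<close> below.\<close>

definition sect :: "'a set \<Rightarrow> ('a list \<Rightarrow> 'a list) \<Rightarrow> 'a \<Rightarrow> 'a list \<Rightarrow> 'a list" where
  "sect X g x = (\<lambda>w\<in>lists X. tl (g (x # w)))"

primrec sect_word :: "'a set \<Rightarrow> ('a list \<Rightarrow> 'a list) \<Rightarrow> 'a list \<Rightarrow> 'a list \<Rightarrow> 'a list" where
  "sect_word X g [] = g"
| "sect_word X g (x # w) = sect_word X (sect X g x) w"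

definition self_similar_group :: "'a set \<Rightarrow> ('a list \<Rightarrow> 'a list) set \<Rightarrow> bool" where
  "self_similar_group X G \<longleftrightarrow>
     finite X \<and> subgroup G (tree_aut X) \<and> (\<forall>g\<in>G. \<forall>x\<in>X. sect X g x \<in> G)"

definition contracting :: "'a set \<Rightarrow> ('a list \<Rightarrow> 'a list) set \<Rightarrow> bool" where
  "contracting X G \<longleftrightarrow> self_similar_group X G \<and>
     (\<exists>N. finite N \<and> N \<subseteq> G \<and>
        (\<forall>g\<in>G. \<exists>n::nat. \<forall>v\<in>lists X. n \<le> length v \<longrightarrow> sect_word X g v \<in> N))"

definition one_inactive_gens :: "nat \<Rightarrow> (nat list \<Rightarrow> nat list) set" where
  "one_inactive_gens k =
     {a \<in> carrier (tree_aut {..<k}).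
        \<exists>j<k. sect {..<k} a j = a \<and> root_perm {..<k} a j = j \<and>
          (\<forall>i<k. i \<noteq> j \<longrightarrow> sect {..<k} a i = \<one>\<^bsub>tree_aut {..<k}\<^esub>)}"

definition H_c :: "nat \<Rightarrow> (nat list \<Rightarrow> nat list) set" where
  "H_c k = generate (tree_aut {..<k}) (one_inactive_gens k)"

lemma tree_aut_carrier_iff:
  "g \<in> carrier (tree_aut X) \<longleftrightarrow> g \<in> Bij (lists X) \<and>
     (\<forall>w \<in> lists X. length (g w) = length w) \<and>
     (\<forall>u \<in> lists X. \<forall>v \<in> lists X.
        g (longest_common_prefix u v) = longest_common_prefix (g u) (g v))"
  by (simp add: tree_aut_def)

lemma tree_aut_mult_one:
  "mult (tree_aut X) = mult (BijGroup (lists X))"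
  "one (tree_aut X) = (\<lambda>w\<in>lists X. w)"
  by (simp_all add: tree_aut_def BijGroup_def)

lemma lcp_in_lists: "u \<in> lists X \<Longrightarrow> longest_common_prefix u v \<in> lists X"
  by (induction u v rule: longest_common_prefix.induct) auto

lemma tree_autD:
  assumes "g \<in> carrier (tree_aut X)"
  shows "g \<in> Bij (lists X)" "bij_betw g (lists X) (lists X)" "g \<in> extensional (lists X)"
    "w \<in> lists X \<Longrightarrow> g w \<in> lists X" "w \<in> lists X \<Longrightarrow> length (g w) = length w"
    "u \<in> lists X \<Longrightarrow> v \<in> lists X \<Longrightarrow>
       g (longest_common_prefix u v) = longest_common_prefix (g u) (g v)"
  using assms by (auto simp: tree_aut_carrier_iff Bij_def bij_betw_def)

lemma subgroup_tree_aut: "subgroup (carrier (tree_aut X)) (BijGroup (lists X))"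
proof -
  interpret B: group "BijGroup (lists X)" by (rule group_BijGroup)
  show ?thesis
  proof (rule B.subgroupI)
    show "carrier (tree_aut X) \<subseteq> carrier (BijGroup (lists X))"
      by (auto simp: tree_aut_carrier_iff BijGroup_def)
    have "(\<lambda>w\<in>lists X. w) \<in> carrier (tree_aut X)"
      using id_Bij[of "lists X"] by (auto simp: tree_aut_carrier_iff lcp_in_lists)
    then show "carrier (tree_aut X) \<noteq> {}" by blast
  next
    fix g assume g: "g \<in> carrier (tree_aut X)"
    define h where "h = restrict (inv_into (lists X) g) (lists X)"
    have inv: "inv\<^bsub>BijGroup (lists X)\<^esub> g = h"
      using tree_autD(1)[OF g] by (simp add: inv_BijGroup h_def)
    have hB: "h \<in> Bij (lists X)"
      unfolding h_def using tree_autD(1)[OF g] by (rule restrict_inv_into_Bij)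
    have hl: "h w \<in> lists X" if "w \<in> lists X" for w
      using hB that by (auto simp: Bij_def bij_betw_def)
    have gh: "g (h w) = w" if "w \<in> lists X" for w
      using that tree_autD(2)[OF g] unfolding h_def
      by (simp add: bij_betw_inv_into_right)
    have hg: "h (g w) = w" if "w \<in> lists X" for w
      using that tree_autD(2,4)[OF g] unfolding h_def
      by (simp add: bij_betw_inv_into_left)
    have "h \<in> carrier (tree_aut X)"
      unfolding tree_aut_carrier_iff
    proof (intro conjI ballI hB)
      fix w assume w: "w \<in> lists X"
      show "length (h w) = length w" using tree_autD(5)[OF g hl[OF w]] gh[OF w] by simp
    next
      fix u v assume u: "u \<in> lists X" and v: "v \<in> lists X"
      have "g (longest_common_prefix (h u) (h v)) = longest_common_prefix u v"
        using tree_autD(6)[OF g hl[OF u] hl[OF v]] gh u v by simp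
      then show "h (longest_common_prefix u v) = longest_common_prefix (h u) (h v)"
        using hg[OF lcp_in_lists[OF hl[OF u], of "h v"]] by simp
    qed
    then show "inv\<^bsub>BijGroup (lists X)\<^esub> g \<in> carrier (tree_aut X)" by (simp add: inv)
  next
    fix g h assume g: "g \<in> carrier (tree_aut X)" and h: "h \<in> carrier (tree_aut X)"
    have "compose (lists X) g h \<in> Bij (lists X)"
      using tree_autD(1)[OF g] tree_autD(1)[OF h] by (rule compose_Bij)
    then have "compose (lists X) g h \<in> carrier (tree_aut X)"
      unfolding tree_aut_carrier_iff
      by (simp add: compose_eq tree_autD(4-6)[OF g] tree_autD(4-6)[OF h] lcp_in_lists)
    then show "g \<otimes>\<^bsub>BijGroup (lists X)\<^esub> h \<in> carrier (tree_aut X)"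
      using tree_autD(1)[OF g] tree_autD(1)[OF h] by (simp add: BijGroup_def)
  qed
qed

lemma group_tree_aut: "group (tree_aut X)"
proof -
  have "group (BijGroup (lists X)\<lparr>carrier := carrier (tree_aut X)\<rparr>)"
    by (rule group.subgroup_imp_group[OF group_BijGroup subgroup_tree_aut])
  then show ?thesis by (simp add: tree_aut_def)
qed

lemma tree_aut_mult:
  assumes "g \<in> carrier (tree_aut X)" "h \<in> carrier (tree_aut X)"
  shows "g \<otimes>\<^bsub>tree_aut X\<^esub> h = compose (lists X) g h"
  using tree_autD(1)[OF assms(1)] tree_autD(1)[OF assms(2)]
  by (simp add: tree_aut_mult_one BijGroup_def)

lemma tree_aut_Cons:
  assumes g: "g \<in> carrier (tree_aut X)" and x: "x \<in> X" and w: "w \<in> lists X"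
  shows "g (x # w) = root_perm X g x # sect X g x w"
proof -
  have xw: "x # w \<in> lists X" and x1: "[x] \<in> lists X" using x w by auto
  obtain y where y: "g [x] = [y]"
    using tree_autD(5)[OF g x1] by (auto simp: length_Suc_conv)
  obtain z zs where z: "g (x # w) = z # zs"
    using tree_autD(5)[OF g xw] by (auto simp: length_Suc_conv)
  have "[y] = longest_common_prefix [y] (z # zs)"
    using tree_autD(6)[OF g x1 xw] y z by simp
  then have "y = z" by (auto split: if_splits)
  then show ?thesis using x w y z by (simp add: root_perm_def sect_def)
qed

lemma root_perm_bij:
  assumes g: "g \<in> carrier (tree_aut X)"
  shows "bij_betw (root_perm X g) X X"
proof -
  have one: "g [x] = [root_perm X g x]" if "x \<in> X" for x
    using tree_autD(5)[OF g, of "[x]"] that by (auto simp: root_perm_def length_Suc_conv)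
  have into: "root_perm X g x \<in> X" if "x \<in> X" for x
    using tree_autD(4)[OF g, of "[x]"] one[OF that] that by auto
  have "inj_on (root_perm X g) X"
  proof (rule inj_onI)
    fix x y assume "x \<in> X" "y \<in> X" "root_perm X g x = root_perm X g y"
    then have "g [x] = g [y]" by (simp add: one)
    then have "[x] = [y]"
      using tree_autD(2)[OF g] \<open>x \<in> X\<close> \<open>y \<in> X\<close> by (auto simp: bij_betw_def dest: inj_onD)
    then show "x = y" by simp
  qed
  moreover have "y \<in> root_perm X g ` X" if "y \<in> X" for y
  proof -
    obtain u where u: "u \<in> lists X" "g u = [y]"
      using tree_autD(2)[OF g] \<open>y \<in> X\<close> unfolding bij_betw_def
      by (metis imageE lists.Cons lists.Nil)
    then have "length u = 1" using tree_autD(5)[OF g u(1)] by simp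
    then obtain x where "u = [x]" by (auto simp: length_Suc_conv)
    then show ?thesis using u one by fastforce
  qed
  ultimately show ?thesis using into by (auto simp: bij_betw_def)
qed

lemma sect_in_tree_aut:
  assumes g: "g \<in> carrier (tree_aut X)" and x: "x \<in> X"
  shows "sect X g x \<in> carrier (tree_aut X)"
proof -
  let ?s = "sect X g x" and ?y = "root_perm X g x"
  have eq: "g (x # w) = ?y # ?s w" if "w \<in> lists X" for w
    by (rule tree_aut_Cons[OF g x that])
  have xl: "x # w \<in> lists X" if "w \<in> lists X" for w using x that by simp
  have into: "?s w \<in> lists X" and len: "length (?s w) = length w" if "w \<in> lists X" for w
    using tree_autD(4,5)[OF g xl[OF that]] eq[OF that] by auto
  have "inj_on ?s (lists X)"
  proof (rule inj_onI)
    fix u v assume u: "u \<in> lists X" and v: "v \<in> lists X" and "?s u = ?s v"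
    then have "g (x # u) = g (x # v)" by (simp only: eq)
    then have "x # u = x # v"
      using tree_autD(2)[OF g] xl[OF u] xl[OF v] by (meson bij_betw_def inj_onD)
    then show "u = v" by simp
  qed
  moreover have "v \<in> ?s ` lists X" if v: "v \<in> lists X" for v
  proof -
    have "?y \<in> X" using root_perm_bij[OF g] x by (auto simp: bij_betw_def)
    then have "?y # v \<in> lists X" using v by simp
    then obtain u where u: "u \<in> lists X" "g u = ?y # v"
      using tree_autD(2)[OF g] unfolding bij_betw_def by (metis imageE)
    then obtain x' u' where u': "u = x' # u'"
      using tree_autD(5)[OF g u(1)] by (cases u) auto
    then have x': "x' \<in> X" "u' \<in> lists X" using u by auto
    have "root_perm X g x' = ?y" "sect X g x' u' = v"
      using tree_aut_Cons[OF g x'] u u' by auto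
    moreover from this(1) have "x' = x"
      using root_perm_bij[OF g] x x'(1) by (meson bij_betw_def inj_onD)
    ultimately show ?thesis using x' by blast
  qed
  ultimately have "bij_betw ?s (lists X) (lists X)" using into by (auto simp: bij_betw_def)
  then have B: "?s \<in> Bij (lists X)" by (simp add: Bij_def sect_def)
  show ?thesis
    unfolding tree_aut_carrier_iff
  proof (intro conjI ballI B)
    fix u v assume u: "u \<in> lists X" and v: "v \<in> lists X"
    show "?s (longest_common_prefix u v) = longest_common_prefix (?s u) (?s v)"
      using tree_autD(6)[OF g xl[OF u] xl[OF v]]
      by (simp add: eq u v lcp_in_lists)
  qed (rule len)
qed

lemma sect_mult:
  assumes g: "g \<in> carrier (tree_aut X)" and h: "h \<in> carrier (tree_aut X)" and x: "x \<in> X"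
  shows "sect X (g \<otimes>\<^bsub>tree_aut X\<^esub> h) x =
    sect X g (root_perm X h x) \<otimes>\<^bsub>tree_aut X\<^esub> sect X h x"
proof -
  have y: "root_perm X h x \<in> X" using root_perm_bij[OF h] x by (auto simp: bij_betw_def)
  note sh = sect_in_tree_aut[OF h x]
  have "sect X (compose (lists X) g h) x w =
      compose (lists X) (sect X g (root_perm X h x)) (sect X h x) w" for w
  proof (cases "w \<in> lists X")
    case True
    then have "sect X (compose (lists X) g h) x w = tl (g (h (x # w)))"
      using x by (simp add: sect_def compose_def)
    also have "\<dots> = sect X g (root_perm X h x) (sect X h x w)"
      using tree_aut_Cons[OF h x True] tree_aut_Cons[OF g y tree_autD(4)[OF sh True]] by simp
    finally show ?thesis using True by (simp add: compose_eq)
  next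
    case False
    then show ?thesis by (auto simp: sect_def compose_def)
  qed
  then show ?thesis
    unfolding tree_aut_mult[OF g h] tree_aut_mult[OF sect_in_tree_aut[OF g y] sh] by (rule ext)
qed

lemma sect_one: "x \<in> X \<Longrightarrow> sect X \<one>\<^bsub>tree_aut X\<^esub> x = \<one>\<^bsub>tree_aut X\<^esub>"
  by (auto simp: tree_aut_mult_one sect_def)

lemma sect_inv:
  assumes g: "g \<in> carrier (tree_aut X)" and x: "x \<in> X"
  shows "sect X (inv\<^bsub>tree_aut X\<^esub> g) (root_perm X g x) = inv\<^bsub>tree_aut X\<^esub> (sect X g x)"
proof -
  interpret T: group "tree_aut X" by (rule group_tree_aut)
  have y: "root_perm X g x \<in> X" using root_perm_bij[OF g] x by (auto simp: bij_betw_def)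
  have gi: "inv\<^bsub>tree_aut X\<^esub> g \<in> carrier (tree_aut X)" using g by simp
  have "sect X (inv\<^bsub>tree_aut X\<^esub> g) (root_perm X g x) \<otimes>\<^bsub>tree_aut X\<^esub> sect X g x
      = \<one>\<^bsub>tree_aut X\<^esub>"
    using sect_mult[OF gi g x] sect_one[OF x] g by simp
  then show ?thesis
    using T.inv_equality sect_in_tree_aut[OF g x] sect_in_tree_aut[OF gi y] by simp
qed

lemma self_similar_H_c: "self_similar_group {..<k} (H_c k)"
proof -
  let ?X = "{..<k}" and ?T = "tree_aut {..<k}"
  interpret T: group ?T by (rule group_tree_aut)
  have S: "one_inactive_gens k \<subseteq> carrier ?T" by (auto simp: one_inactive_gens_def)
  have sub: "subgroup (H_c k) ?T" unfolding H_c_def by (rule T.generate_is_subgroup[OF S])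
  have car: "g \<in> carrier ?T" if "g \<in> H_c k" for g
    using subgroup.subset[OF sub] that by blast
  have gen: "sect ?X a x \<in> H_c k" if a: "a \<in> one_inactive_gens k" and x: "x \<in> ?X" for a x
  proof -
    obtain j where j: "sect ?X a j = a" "\<And>i. i < k \<Longrightarrow> i \<noteq> j \<Longrightarrow> sect ?X a i = \<one>\<^bsub>?T\<^esub>"
      using a by (auto simp: one_inactive_gens_def)
    show ?thesis
    proof (cases "x = j")
      case True
      then show ?thesis using j(1) generate.incl[OF a, of ?T] by (simp add: H_c_def)
    next
      case False
      then show ?thesis using j(2)[of x] x subgroup.one_closed[OF sub] by simp
    qed
  qed
  have "\<forall>x\<in>?X. sect ?X g x \<in> H_c k" if "g \<in> H_c k" for g
    using that unfolding H_c_def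
  proof (induction g rule: generate.induct)
    case one
    then show ?case by (simp add: sect_one generate.one)
  next
    case (incl a)
    then show ?case using gen by (simp add: H_c_def)
  next
    case (inv a)
    have a: "a \<in> carrier ?T" using inv S by blast
    show ?case
    proof
      fix y assume "y \<in> ?X"
      then obtain x where x: "x \<in> ?X" "y = root_perm ?X a x"
        using root_perm_bij[OF a] unfolding bij_betw_def by (metis imageE)
      show "sect ?X (inv\<^bsub>?T\<^esub> a) y \<in> generate ?T (one_inactive_gens k)"
        using subgroup.m_inv_closed[OF sub gen[OF inv x(1)]] sect_inv[OF a x(1)] x(2)
        by (simp add: H_c_def)
    qed
  next
    case (eng g h)
    have g: "g \<in> carrier ?T" and h: "h \<in> carrier ?T" using eng car by (auto simp: H_c_def)
    show ?case
    proof
      fix x assume x: "x \<in> ?X"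
      have "root_perm ?X h x \<in> ?X" using root_perm_bij[OF h] x by (auto simp: bij_betw_def)
      then show "sect ?X (g \<otimes>\<^bsub>?T\<^esub> h) x \<in> generate ?T (one_inactive_gens k)"
        using eng.IH x by (simp add: sect_mult[OF g h x] generate.eng)
    qed
  qed
  then show ?thesis using sub by (simp add: self_similar_group_def)
qed

end

theory Submission
  imports Defs
begin

text \<open>
  For a fixed peg \<open>j\<close> the generators with inactive peg \<open>j\<close> form a subgroup, so a product of
  generators shortens as soon as two neighbouring factors share their inactive peg. Now follow a
  letter \<open>x\<close> through a product of \<open>n\<close> generators: a factor survives in the section at \<open>x\<close> only if it
  meets the current letter on its inactive peg, and then it leaves that letter fixed; any other
  factor contributes the identity. Hence all factors survive only if all of them have the inactive peg \<open>x\<close>,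
  and then the product is a single generator (lemma \<open>word_ball_sect_cases\<close>). It follows that the
  sections of a product of \<open>n + 1 \<ge> 2\<close> generators are products of \<open>n\<close> generators, and the sections
  of a generator are generators. Sections at words of length at least \<open>n\<close> are therefore generators,
  and the nucleus can be taken to be the generating set itself. This set is finite because a
  generator is determined by its inactive peg and its root permutation.
\<close>

section \<open>Root permutations of products\<close>

lemma root_perm_in:
  assumes "g \<in> carrier (tree_aut X)" "x \<in> X"
  shows "root_perm X g x \<in> X"
  using root_perm_bij[OF assms(1)] assms(2) by (auto simp: bij_betw_def)

lemma root_perm_one: "x \<in> X \<Longrightarrow> root_perm X \<one>\<^bsub>tree_aut X\<^esub> x = x"
  by (simp add: root_perm_def tree_aut_mult_one)

lemma root_perm_mult:
  assumes g: "g \<in> carrier (tree_aut X)" and h: "h \<in> carrier (tree_aut X)" and x: "x \<in> X"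
  shows "root_perm X (g \<otimes>\<^bsub>tree_aut X\<^esub> h) x = root_perm X g (root_perm X h x)"
proof -
  have y: "root_perm X h x \<in> X" by (rule root_perm_in[OF h x])
  have "h [x] = root_perm X h x # sect X h x []"
    by (rule tree_aut_Cons[OF h x]) simp
  moreover have "g (root_perm X h x # sect X h x []) =
      root_perm X g (root_perm X h x) # sect X g (root_perm X h x) (sect X h x [])"
    by (rule tree_aut_Cons[OF g y tree_autD(4)[OF sect_in_tree_aut[OF h x]]]) simp
  moreover have "root_perm X (compose (lists X) g h) x = hd (g (h [x]))"
    using x by (simp add: root_perm_def compose_eq)
  ultimately show ?thesis by (simp add: tree_aut_mult[OF g h])
qed

section \<open>Generators with a given inactive peg\<close>

definition inactive_at :: "'a set \<Rightarrow> 'a \<Rightarrow> ('a list \<Rightarrow> 'a list) set" where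
  "inactive_at X j =
     {a \<in> carrier (tree_aut X). sect X a j = a \<and> root_perm X a j = j \<and>
        (\<forall>i\<in>X. i \<noteq> j \<longrightarrow> sect X a i = \<one>\<^bsub>tree_aut X\<^esub>)}"

lemma one_inactive_gens_eq: "one_inactive_gens k = (\<Union>j<k. inactive_at {..<k} j)"
  by (auto simp: one_inactive_gens_def inactive_at_def)

lemma inactive_atD:
  assumes "a \<in> inactive_at X j"
  shows "a \<in> carrier (tree_aut X)" "sect X a j = a" "root_perm X a j = j"
    "i \<in> X \<Longrightarrow> i \<noteq> j \<Longrightarrow> sect X a i = \<one>\<^bsub>tree_aut X\<^esub>"
  using assms by (auto simp: inactive_at_def)

lemma inactive_at_perm_ne:
  assumes a: "a \<in> inactive_at X j" and j: "j \<in> X" and i: "i \<in> X" "i \<noteq> j"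
  shows "root_perm X a i \<noteq> j"
  using root_perm_bij[OF inactive_atD(1)[OF a]] inactive_atD(3)[OF a] i j
  by (metis bij_betw_def inj_onD)

lemma subgroup_inactive_at:
  assumes j: "j \<in> X"
  shows "subgroup (inactive_at X j) (tree_aut X)"
proof -
  interpret T: group "tree_aut X" by (rule group_tree_aut)
  show ?thesis
  proof (rule T.subgroupI)
    show "inactive_at X j \<subseteq> carrier (tree_aut X)" by (auto simp: inactive_at_def)
    show "inactive_at X j \<noteq> {}"
      using j by (auto simp: inactive_at_def sect_one root_perm_one intro!: exI[of _ "\<one>\<^bsub>tree_aut X\<^esub>"])
  next
    fix a assume a: "a \<in> inactive_at X j"
    note aD = inactive_atD[OF a]
    have "sect X (inv\<^bsub>tree_aut X\<^esub> a) i = \<one>\<^bsub>tree_aut X\<^esub>" if i: "i \<in> X" "i \<noteq> j" for i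
    proof -
      obtain l where l: "l \<in> X" "i = root_perm X a l"
        using root_perm_bij[OF aD(1)] i(1) unfolding bij_betw_def by (metis imageE)
      moreover have "l \<noteq> j" using l i(2) aD(3) by auto
      ultimately show ?thesis using sect_inv[OF aD(1) l(1)] aD(4) by simp
    qed
    moreover have "sect X (inv\<^bsub>tree_aut X\<^esub> a) j = inv\<^bsub>tree_aut X\<^esub> a"
      using sect_inv[OF aD(1) j] aD by simp
    moreover have "root_perm X (inv\<^bsub>tree_aut X\<^esub> a) j = j"
      using root_perm_mult[OF T.inv_closed[OF aD(1)] aD(1) j] aD(1,3) root_perm_one[OF j] by simp
    ultimately show "inv\<^bsub>tree_aut X\<^esub> a \<in> inactive_at X j"
      using aD(1) by (simp add: inactive_at_def)
  next
    fix a b assume a: "a \<in> inactive_at X j" and b: "b \<in> inactive_at X j"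
    note aD = inactive_atD[OF a] and bD = inactive_atD[OF b]
    have "sect X (a \<otimes>\<^bsub>tree_aut X\<^esub> b) i = \<one>\<^bsub>tree_aut X\<^esub>" if i: "i \<in> X" "i \<noteq> j" for i
      using sect_mult[OF aD(1) bD(1) i(1)] bD(4)[OF i]
        aD(4)[OF root_perm_in[OF bD(1) i(1)] inactive_at_perm_ne[OF b j i]] by simp
    then show "a \<otimes>\<^bsub>tree_aut X\<^esub> b \<in> inactive_at X j"
      using aD bD sect_mult[OF aD(1) bD(1) j] root_perm_mult[OF aD(1) bD(1) j]
      by (simp add: inactive_at_def)
  qed
qed

text \<open>
  The action of \<open>a\<close> with inactive peg \<open>j\<close> is forced by its root permutation: a word that starts with
  another letter has only that letter changed, and a leading \<open>j\<close> is kept while \<open>a\<close> acts on the rest.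
\<close>

lemma inactive_at_eqI:
  assumes a: "a \<in> inactive_at X j" and b: "b \<in> inactive_at X j"
    and eq: "root_perm X a = root_perm X b"
  shows "a = b"
proof (rule extensionalityI)
  note aD = inactive_atD[OF a] and bD = inactive_atD[OF b]
  show "a \<in> extensional (lists X)" "b \<in> extensional (lists X)"
    using tree_autD(3) aD(1) bD(1) by blast+
  show "a w = b w" if "w \<in> lists X" for w
    using that
  proof (induction w)
    case Nil
    then show ?case using tree_autD(5)[OF aD(1), of "[]"] tree_autD(5)[OF bD(1), of "[]"] by simp
  next
    case (Cons x w)
    then have "sect X a x w = sect X b x w"
      using aD bD by (cases "x = j") auto
    then show ?case
      using Cons.hyps tree_aut_Cons[OF aD(1)] tree_aut_Cons[OF bD(1)] eq by simp
  qed
qed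

lemma finite_inactive_at:
  assumes "finite X"
  shows "finite (inactive_at X j)"
proof (rule finite_imageD)
  have "root_perm X ` inactive_at X j \<subseteq> X \<rightarrow>\<^sub>E X"
    by (auto simp: PiE_iff root_perm_in inactive_atD(1)) (simp add: root_perm_def)
  then show "finite (root_perm X ` inactive_at X j)"
    by (rule finite_subset) (simp add: assms finite_PiE)
  show "inj_on (root_perm X) (inactive_at X j)"
    by (auto intro: inj_onI inactive_at_eqI)
qed

section \<open>Products of a given number of generators\<close>

primrec word_ball :: "('a, 'b) monoid_scheme \<Rightarrow> 'a set \<Rightarrow> nat \<Rightarrow> 'a set" where
  "word_ball G S 0 = {\<one>\<^bsub>G\<^esub>}"
| "word_ball G S (Suc n) = S <#>\<^bsub>G\<^esub> word_ball G S n"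

context group
begin

lemma word_ball_closed: "S \<subseteq> carrier G \<Longrightarrow> word_ball G S n \<subseteq> carrier G"
  by (induction n) (auto simp: set_mult_def)

lemma word_ball_1: "S \<subseteq> carrier G \<Longrightarrow> word_ball G S 1 = S"
  by (force simp: set_mult_def)

text \<open>As the identity counts as a generator, products can be padded; so the number of factors acts
  as an upper bound for word length.\<close>

lemma word_ball_mono:
  assumes S: "S \<subseteq> carrier G" and one: "\<one> \<in> S" and le: "m \<le> n"
  shows "word_ball G S m \<subseteq> word_ball G S n"
proof (rule lift_Suc_mono_le[of "word_ball G S", OF _ le])
  show "word_ball G S l \<subseteq> word_ball G S (Suc l)" for l
  proof
    fix g assume g: "g \<in> word_ball G S l"
    then have "g = \<one> \<otimes> g" using word_ball_closed[OF S, of l] by auto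
    then show "g \<in> word_ball G S (Suc l)" using one g by (auto simp: set_mult_def)
  qed
qed

lemma word_ball_mult:
  assumes S: "S \<subseteq> carrier G" and g: "g \<in> word_ball G S m" and h: "h \<in> word_ball G S n"
  shows "g \<otimes> h \<in> word_ball G S (m + n)"
  using g
proof (induction m arbitrary: g)
  case 0
  then show ?case using h word_ball_closed[OF S, of n] by auto
next
  case (Suc m)
  then obtain s g' where s: "s \<in> S" "g' \<in> word_ball G S m" "g = s \<otimes> g'"
    by (auto simp: set_mult_def)
  then have "g \<otimes> h = s \<otimes> (g' \<otimes> h)"
    using S h word_ball_closed[OF S] by (auto simp: m_assoc subset_iff)
  then show ?case using Suc.IH[OF s(2)] s(1) by (auto simp: set_mult_def)
qed

lemma generate_subset_word_ball:
  assumes S: "S \<subseteq> carrier G" and inv: "\<And>s. s \<in> S \<Longrightarrow> inv s \<in> S"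
  shows "generate G S \<subseteq> (\<Union>n. word_ball G S n)"
proof
  fix g assume "g \<in> generate G S"
  then show "g \<in> (\<Union>n. word_ball G S n)"
  proof (induction rule: generate.induct)
    case one
    show ?case by (rule UN_I[of 0]) auto
  next
    case (incl s)
    then show ?case using word_ball_1[OF S] by blast
  next
    case (inv s)
    then show ?case using word_ball_1[OF S] assms(2) by blast
  next
    case (eng g h)
    then show ?case using word_ball_mult[OF S] by blast
  qed
qed

end

section \<open>Sections shorten products\<close>

text \<open>
  Factors act from right to left. As long as the first alternative holds, the letter \<open>x\<close> has not
  moved, so the next factor either has the inactive peg \<open>x\<close> too and is absorbed into the subgroup,
  or has a trivial section at \<open>x\<close>. In the latter case a factor has been lost, and it stays lost,
  because every later factor adds at most one generator to the section.
\<close>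

lemma word_ball_sect_cases:
  fixes X :: "'a set"
  defines "S \<equiv> \<Union>j\<in>X. inactive_at X j"
  assumes x: "x \<in> X" and g: "g \<in> word_ball (tree_aut X) S n"
  shows "g \<in> inactive_at X x \<or> (\<exists>m. n = Suc m \<and> sect X g x \<in> word_ball (tree_aut X) S m)"
  using g
proof (induction n arbitrary: g)
  case 0
  then show ?case using subgroup.one_closed[OF subgroup_inactive_at[OF x]] by simp
next
  case (Suc n)
  interpret T: group "tree_aut X" by (rule group_tree_aut)
  have S: "S \<subseteq> carrier (tree_aut X)" by (auto simp: S_def inactive_at_def)
  obtain s h where s: "s \<in> S" and h: "h \<in> word_ball (tree_aut X) S n"
    and g: "g = s \<otimes>\<^bsub>tree_aut X\<^esub> h"
    using Suc.prems by (auto simp: set_mult_def)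
  obtain j where j: "j \<in> X" "s \<in> inactive_at X j" using s by (auto simp: S_def)
  note sD = inactive_atD[OF j(2)]
  have hc: "h \<in> carrier (tree_aut X)" using h T.word_ball_closed[OF S] by blast
  have sect_g: "sect X g x = sect X s (root_perm X h x) \<otimes>\<^bsub>tree_aut X\<^esub> sect X h x"
    unfolding g by (rule sect_mult[OF sD(1) hc x])
  from Suc.IH[OF h] show ?case
  proof
    assume hx: "h \<in> inactive_at X x"
    show ?thesis
    proof (cases "j = x")
      case True
      then show ?thesis
        using subgroup.m_closed[OF subgroup_inactive_at[OF x]] j(2) hx g by simp
    next
      case False
      then have "sect X g x = h"
        using sect_g inactive_atD[OF hx] sD(4)[OF x] by simp
      then show ?thesis using h by simp
    qed
  next
    assume "\<exists>m. n = Suc m \<and> sect X h x \<in> word_ball (tree_aut X) S m"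
    moreover have "sect X s (root_perm X h x) \<in> S"
    proof (cases "root_perm X h x = j")
      case True
      then show ?thesis using sD(2) s by simp
    next
      case False
      then show ?thesis
        using sD(4)[OF root_perm_in[OF hc x]] j(1)
          subgroup.one_closed[OF subgroup_inactive_at[OF j(1)]] by (auto simp: S_def)
    qed
    ultimately have "sect X g x \<in> word_ball (tree_aut X) S n"
      unfolding sect_g by (fastforce simp: set_mult_def)
    then show ?thesis by simp
  qed
qed

text \<open>Truncated subtraction makes one statement of two: products of at least two generators lose
  a factor, and sections of a single generator are single generators.\<close>

lemma word_ball_sect:
  fixes X :: "'a set"
  defines "S \<equiv> \<Union>j\<in>X. inactive_at X j"
  assumes x: "x \<in> X" and g: "g \<in> word_ball (tree_aut X) S (Suc n)"
  shows "sect X g x \<in> word_ball (tree_aut X) S (Suc (n - 1))"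
proof -
  interpret T: group "tree_aut X" by (rule group_tree_aut)
  have S: "S \<subseteq> carrier (tree_aut X)" by (auto simp: S_def inactive_at_def)
  have one: "\<one>\<^bsub>tree_aut X\<^esub> \<in> S"
    using subgroup.one_closed[OF subgroup_inactive_at[OF x]] x by (auto simp: S_def)
  have mono: "word_ball (tree_aut X) S l \<subseteq> word_ball (tree_aut X) S (Suc (n - 1))"
    if "l \<le> Suc (n - 1)" for l
    by (rule T.word_ball_mono[OF S one that])
  consider "g \<in> inactive_at X x" | "sect X g x \<in> word_ball (tree_aut X) S n"
    using word_ball_sect_cases[OF x g[unfolded S_def]] by (auto simp: S_def)
  then show ?thesis
  proof cases
    case 1
    then have "sect X g x \<in> word_ball (tree_aut X) S 1"
      unfolding T.word_ball_1[OF S] using inactive_atD(2)[of g X x] x by (auto simp: S_def)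
    then show ?thesis using mono[of 1] by auto
  next
    case 2
    moreover have "n \<le> Suc (n - 1)" by simp
    ultimately show ?thesis using mono by blast
  qed
qed

lemma word_ball_sect_word:
  fixes X :: "'a set"
  defines "S \<equiv> \<Union>j\<in>X. inactive_at X j"
  assumes "v \<in> lists X" "g \<in> word_ball (tree_aut X) S (Suc n)"
  shows "sect_word X g v \<in> word_ball (tree_aut X) S (Suc (n - length v))"
  using assms(2,3)
proof (induction v arbitrary: g n)
  case Nil
  then show ?case by simp
next
  case (Cons x v)
  have "sect X g x \<in> word_ball (tree_aut X) S (Suc (n - 1))"
    using word_ball_sect[of x X g n] Cons.hyps(1) Cons.prems by (simp add: S_def)
  from Cons.IH[OF this] show ?case by simp
qed

theorem corollary5p2:
  fixes k :: nat
  assumes "3 \<le> k"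
  shows "contracting {..<k} (H_c k)"
proof -
  let ?X = "{..<k}"
  define S where "S = (\<Union>j\<in>?X. inactive_at ?X j)"
  interpret T: group "tree_aut ?X" by (rule group_tree_aut)
  have S: "S \<subseteq> carrier (tree_aut ?X)" by (auto simp: S_def inactive_at_def)
  have one: "\<one>\<^bsub>tree_aut ?X\<^esub> \<in> S"
    using subgroup.one_closed[OF subgroup_inactive_at[of 0 ?X]] assms by (auto simp: S_def)
  have inv: "inv\<^bsub>tree_aut ?X\<^esub> s \<in> S" if "s \<in> S" for s
    using that subgroup.m_inv_closed[OF subgroup_inactive_at[of _ ?X]] by (auto simp: S_def)
  have H: "H_c k = generate (tree_aut ?X) S"
    by (simp add: H_c_def one_inactive_gens_eq S_def)
  have "\<exists>n. \<forall>v\<in>lists ?X. n \<le> length v \<longrightarrow> sect_word ?X g v \<in> S" if g: "g \<in> H_c k" for g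
  proof -
    obtain n where "g \<in> word_ball (tree_aut ?X) S n"
      using g T.generate_subset_word_ball[OF S inv] by (auto simp: H)
    then have "g \<in> word_ball (tree_aut ?X) S (Suc n)"
      using T.word_ball_mono[OF S one, of n "Suc n"] by auto
    then have "sect_word ?X g v \<in> S" if "v \<in> lists ?X" "n \<le> length v" for v
      using word_ball_sect_word[OF that(1), of g n] that(2) T.word_ball_1[OF S]
      by (simp add: S_def)
    then show ?thesis by blast
  qed
  moreover have "finite S" by (simp add: S_def finite_inactive_at)
  moreover have "S \<subseteq> H_c k" by (auto simp: H intro: generate.incl)
  ultimately show ?thesis
    unfolding contracting_def using self_similar_H_c by blast
qed

end
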